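(* Let $2\le p<q\le n$. For integers $0<i_q<q$, $0<i_p<p$, $0<i_q'<q$, $0<i_p'<p$, the standard OGS canonical form of $t_{q}^{i_{q}}\cdot t_{p}^{i_{p}}$ and the dual-standard OGS canonical form of $t_{p}^{i_p'}\cdot t_{q}^{i_q'}$ are products of non-zero powers of at most three different canonical generators, where the following holds: (1) The standard OGS canonical form of $t_{q}^{i_{q}}\cdot t_{p}^{i_{p}}$ is a product of non-zero powers of two different canonical generators if and only if $q-i_{q}=p$ or $q-i_{q}=i_{p}$, and then $$ t_{q}^{i_{q}}\cdot t_{p}^{i_{p}}=\begin{cases} t_{i_{q}+i_{p}}^{i_q}\cdot t_{q}^{i_{q}+i_{p}} & \text{if } q-i_{q} = p, \\ t_{i_{q}}^{p-i_{p}}\cdot t_{q}^{q-p} & \text{if } q-i_{q} = i_{p}. \end{cases}$$ (2) The dual-standard OGS canonical form of $t_{p}^{i_p'}\cdot t_{q}^{i_q'}$ is a product of non-zero powers of two different canonical generators if and only if $i_q'=p$ or $i_q'=p-i_p'$, and then $$ t_{p}^{i_p'}\cdot t_{q}^{i_q'}=\begin{cases} t_{q}^{i_p'}\cdot t_{q-i_p'}^{p-i_p'} & \text{if } i_q' = p, \\ t_{q}^{p}\cdot t_{q-i_q'}^{q-p} & \text{if } i_q' = p-i_p'. \end{cases}$$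
   Context: $S_n$ is the group of permutations of $\{1,\dots,n\}$, with products taken from left to right: $(\pi_1\cdot\pi_2)(i)=\pi_2(\pi_1(i))$. $s_i$ is the transposition $(i,i+1)$. For $2\le m\le n$, $t_m=s_1s_2\cdots s_{m-1}$; it has order $m$. The elements $t_2,\dots,t_n$ are the canonical generators. Every element of $S_n$ has a unique presentation $t_2^{i_2}t_3^{i_3}\cdots t_n^{i_n}$ with $0\le i_k<k$ (standard OGS canonical form), and a unique presentation $t_n^{i_n}t_{n-1}^{i_{n-1}}\cdots t_2^{i_2}$ with $0\le i_k<k$ (dual-standard OGS canonical form). *)

theory Defs
  imports "HOL-Algebra.Group" "HOL-Combinatorics.Permutations"
begin

(* Products are taken from left to right, (\<pi>1 \<cdot> \<pi>2)(i) = \<pi>2 (\<pi>1 i), so this is the opposite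
   of the group sym_group n of HOL-Algebra. *)
definition Sym :: "nat \<Rightarrow> (nat \<Rightarrow> nat) monoid" where
  "Sym n = \<lparr>carrier = {\<pi>. \<pi> permutes {1..n}}, monoid.mult = (\<lambda>\<pi>1 \<pi>2. \<pi>2 \<circ> \<pi>1), one = id\<rparr>"

definition list_mult :: "('a, 'b) monoid_scheme \<Rightarrow> 'a list \<Rightarrow> 'a" where
  "list_mult G xs = foldr (\<lambda>x y. x \<otimes>\<^bsub>G\<^esub> y) xs \<one>\<^bsub>G\<^esub>"

definition s :: "nat \<Rightarrow> nat \<Rightarrow> nat" where
  "s i = transpose i (i + 1)"

(* t_m = s_1 s_2 ... s_(m-1), computed in Sym n; only used for 2 \<le> m \<le> n. *)
definition t :: "nat \<Rightarrow> nat \<Rightarrow> nat \<Rightarrow> nat" where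
  "t n m = list_mult (Sym n) (map s [1..<m])"

(* Exponents (i_2, ..., i_n) with 0 \<le> i_k < k, extended by 0 to functions on all of nat so that
   a presentation determines the function uniquely. *)
definition ogs_exponents :: "nat \<Rightarrow> (nat \<Rightarrow> nat) set" where
  "ogs_exponents n = {e. (\<forall>k\<in>{2..n}. e k < k) \<and> (\<forall>k. k \<notin> {2..n} \<longrightarrow> e k = 0)}"

definition std_product :: "nat \<Rightarrow> (nat \<Rightarrow> nat) \<Rightarrow> nat \<Rightarrow> nat" where
  "std_product n e = list_mult (Sym n) (map (\<lambda>k. t n k [^]\<^bsub>Sym n\<^esub> e k) [2..<n + 1])"

definition dual_std_product :: "nat \<Rightarrow> (nat \<Rightarrow> nat) \<Rightarrow> nat \<Rightarrow> nat" where
  "dual_std_product n e =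
     list_mult (Sym n) (map (\<lambda>k. t n k [^]\<^bsub>Sym n\<^esub> e k) (rev [2..<n + 1]))"

(* The exponents of the two canonical forms of a permutation; every element of Sym n has exactly
   one presentation of each kind, so the descriptions below are proper on its carrier. *)
definition std_form :: "nat \<Rightarrow> (nat \<Rightarrow> nat) \<Rightarrow> nat \<Rightarrow> nat" where
  "std_form n \<pi> = (THE e. e \<in> ogs_exponents n \<and> std_product n e = \<pi>)"

definition dual_std_form :: "nat \<Rightarrow> (nat \<Rightarrow> nat) \<Rightarrow> nat \<Rightarrow> nat" where
  "dual_std_form n \<pi> = (THE e. e \<in> ogs_exponents n \<and> dual_std_product n e = \<pi>)"

(* The indices k such that t_k occurs with a non-zero power. *)
definition occurring :: "(nat \<Rightarrow> nat) \<Rightarrow> nat set" where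
  "occurring e = {k. e k \<noteq> 0}"

end

theory Submission
  imports Defs
begin

text \<open>
  Since products are read from left to right, \<open>t\<^sub>m\<close> sends \<open>1\<close> to \<open>m\<close> and every other
  \<open>k \<le> m\<close> to \<open>k - 1\<close>. So \<open>t\<^sub>m\<^sup>i\<close> exchanges two adjacent blocks: it moves
  \<open>{1..i}\<close> to the end of \<open>{1..m}\<close> and slides \<open>{i+1..m}\<close> down to the front
  (\<open>rotation\<close>, \<open>t_pow_eq_rotation\<close>).

  The last exponent of a standard form can be read off at one point. All factors before
  \<open>t\<^sub>m\<^sup>e\<close> fix \<open>m\<close>, so the product of the first factors up to this one sends \<open>m\<close> to
  \<open>m - e\<close>. This gives the uniqueness of the exponents (\<open>std_product_inj\<close>), and it also shows
  where the formulas come from: with \<open>x = t\<^sub>q\<^sup>a t\<^sub>p\<^sup>b\<close> the exponent of \<open>t\<^sub>q\<close> is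
  \<open>q - x(q)\<close> modulo \<open>q\<close>, and what remains after removing this power of \<open>t\<^sub>q\<close> merely
  exchanges two adjacent blocks \<open>{A+1..A+B}\<close> and \<open>{A+B+1..C}\<close>. Such an exchange is
  \<open>t\<^sub>A\<^sub>+\<^sub>B\<^sup>A t\<^sub>C\<^sup>B\<close>: the first factor brings \<open>{A+1..A+B}\<close> to the front, and
  the second one carries it past everything else. Depending on the position of \<open>q - a\<close> relative
  to \<open>b\<close> and \<open>p\<close>, this yields three factors with indices \<open>A + B < C < q\<close>, except in the two
  boundary cases \<open>q - a = p\<close> and \<open>q - a = b\<close>, where \<open>C = q\<close> and the last two factors merge into
  a single power of \<open>t\<^sub>q\<close>.

  Inversion reverses a product and replaces the exponent \<open>e > 0\<close> of \<open>t\<^sub>k\<close> by \<open>k - e\<close>.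
  It therefore turns standard forms into dual-standard ones with the same generators occurring
  (\<open>dual_std_form_eq\<close>), and the claims about \<open>t\<^sub>p\<^sup>i t\<^sub>q\<^sup>j\<close> are those about its inverse
  \<open>t\<^sub>q\<^sup>q\<^sup>-\<^sup>j t\<^sub>p\<^sup>p\<^sup>-\<^sup>i\<close>.
\<close>

section \<open>Products of lists in a group\<close>

lemma list_mult_Nil [simp]: "list_mult G [] = \<one>\<^bsub>G\<^esub>"
  by (simp add: list_mult_def)

lemma list_mult_Cons [simp]: "list_mult G (x # xs) = x \<otimes>\<^bsub>G\<^esub> list_mult G xs"
  by (simp add: list_mult_def)

lemma (in monoid) list_mult_closed:
  "set xs \<subseteq> carrier G \<Longrightarrow> list_mult G xs \<in> carrier G"
  by (induction xs) auto

lemma (in monoid) list_mult_append: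
  "set xs \<subseteq> carrier G \<Longrightarrow> set ys \<subseteq> carrier G \<Longrightarrow>
    list_mult G (xs @ ys) = list_mult G xs \<otimes> list_mult G ys"
  by (induction xs) (auto simp: m_assoc list_mult_closed)

lemma (in group) inv_list_mult:
  "set xs \<subseteq> carrier G \<Longrightarrow> inv (list_mult G xs) = list_mult G (rev (map (\<lambda>x. inv x) xs))"
proof (induction xs)
  case (Cons x xs)
  have "set (rev (map (\<lambda>x. inv x) xs)) \<subseteq> carrier G"
    using Cons.prems by auto
  then show ?case
    using Cons by (auto simp: inv_mult_group list_mult_closed list_mult_append)
qed simp

lemma (in monoid) list_mult_map_filter:
  assumes "set ks \<subseteq> K" "\<And>k. k \<in> K \<Longrightarrow> f k \<in> carrier G"
    and "\<And>k. k \<in> set ks \<Longrightarrow> \<not> P k \<Longrightarrow> f k = \<one>"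
  shows "list_mult G (map f (filter P ks)) = list_mult G (map f ks)"
  using assms
proof (induction ks)
  case (Cons k ks)
  have "list_mult G (map f ks) \<in> carrier G"
    using Cons.prems by (intro list_mult_closed) auto
  then show ?case
    using Cons by auto
qed simp

section \<open>Powers of the canonical generators\<close>

lemma Sym_simps:
  "carrier (Sym n) = {\<pi>. \<pi> permutes {1..n}}"
  "f \<otimes>\<^bsub>Sym n\<^esub> g = g \<circ> f"
  "\<one>\<^bsub>Sym n\<^esub> = id"
  by (simp_all add: Sym_def)

lemma group_Sym: "group (Sym n)"
proof (rule groupI)
  fix f assume "f \<in> carrier (Sym n)"
  then have "f permutes {1..n}"
    by (simp add: Sym_simps)
  then show "\<exists>g\<in>carrier (Sym n). g \<otimes>\<^bsub>Sym n\<^esub> f = \<one>\<^bsub>Sym n\<^esub>"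
    by (intro bexI[of _ "inv_into UNIV f"])
      (auto simp: Sym_simps permutes_inv permutes_inv_o)
qed (auto simp: Sym_simps permutes_compose permutes_id comp_assoc)

text \<open>
  The power \<open>t\<^sub>m\<^sup>i\<close> in closed form. The value \<open>i = m\<close>, which gives the identity, is allowed:
  boundary cases and inverses produce it.
\<close>

definition rotation :: "nat \<Rightarrow> nat \<Rightarrow> nat \<Rightarrow> nat" where
  "rotation m i k = (if 1 \<le> k \<and> k \<le> m then if i < k then k - i else k + m - i else k)"

lemma rotation_0 [simp]: "rotation m 0 = id"
  by (auto simp: rotation_def)

lemma rotation_self: "rotation m m = id"
  by (auto simp: rotation_def)

lemma s_in_Sym: "1 \<le> i \<Longrightarrow> i < n \<Longrightarrow> s i \<in> carrier (Sym n)"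
  by (auto simp: s_def Sym_simps intro!: permutes_swap_id)

lemma t_in_Sym:
  assumes "m \<le> n"
  shows "t n m \<in> carrier (Sym n)"
  unfolding t_def
  using assms by (intro monoid.list_mult_closed[OF group.is_monoid[OF group_Sym]])
    (auto intro!: s_in_Sym)

lemma t_pow_in_Sym: "m \<le> n \<Longrightarrow> t n m [^]\<^bsub>Sym n\<^esub> (i::nat) \<in> carrier (Sym n)"
  by (intro monoid.nat_pow_closed[OF group.is_monoid[OF group_Sym]] t_in_Sym)

lemma t_Suc:
  assumes "1 \<le> m" "m < n"
  shows "t n (Suc m) = s m \<circ> t n m"
proof -
  have "list_mult (Sym n) (map s [1..<m] @ [s m])
      = list_mult (Sym n) (map s [1..<m]) \<otimes>\<^bsub>Sym n\<^esub> list_mult (Sym n) [s m]"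
    using assms by (intro monoid.list_mult_append[OF group.is_monoid[OF group_Sym]])
      (auto intro!: s_in_Sym)
  then show ?thesis
    using assms by (simp add: t_def Sym_simps)
qed

lemma t_eq_rotation:
  assumes "1 \<le> m" "m \<le> n"
  shows "t n m = rotation m 1"
  using assms
proof (induction m rule: dec_induct)
  case base
  then show ?case
    by (simp add: t_def Sym_simps rotation_self[of 1, simplified])
next
  case (step m)
  then have "t n (Suc m) = s m \<circ> rotation m 1"
    by (simp add: t_Suc)
  also have "\<dots> = rotation (Suc m) 1"
    using step by (auto simp: fun_eq_iff rotation_def s_def transpose_def)
  finally show ?case .
qed

lemma t_pow_eq_rotation:
  assumes "m \<le> n" "i \<le> m"
  shows "t n m [^]\<^bsub>Sym n\<^esub> i = rotation m i"
  using assms(2)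
proof (induction i)
  case 0
  then show ?case
    by (simp add: Sym_simps)
next
  case (Suc i)
  then have "t n m [^]\<^bsub>Sym n\<^esub> Suc i = rotation m 1 \<circ> rotation m i"
    using assms by (simp add: Sym_simps t_eq_rotation)
  also have "\<dots> = rotation m (Suc i)"
    using Suc.prems by (auto simp: fun_eq_iff rotation_def)
  finally show ?case .
qed

lemma inv_t_pow:
  assumes "m \<le> n" "i \<le> m"
  shows "inv\<^bsub>Sym n\<^esub> (t n m [^]\<^bsub>Sym n\<^esub> i) = t n m [^]\<^bsub>Sym n\<^esub> (m - i)"
proof (rule group.inv_equality[OF group_Sym])
  have "t n m [^]\<^bsub>Sym n\<^esub> (m - i) \<otimes>\<^bsub>Sym n\<^esub> t n m [^]\<^bsub>Sym n\<^esub> i = t n m [^]\<^bsub>Sym n\<^esub> m"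
    using assms by (simp add: monoid.nat_pow_mult[OF group.is_monoid[OF group_Sym]] t_in_Sym)
  also have "\<dots> = \<one>\<^bsub>Sym n\<^esub>"
    using assms by (simp add: t_pow_eq_rotation rotation_self Sym_simps)
  finally show "t n m [^]\<^bsub>Sym n\<^esub> (m - i) \<otimes>\<^bsub>Sym n\<^esub> t n m [^]\<^bsub>Sym n\<^esub> i = \<one>\<^bsub>Sym n\<^esub>" .
qed (use assms in \<open>auto intro: t_pow_in_Sym\<close>)

section \<open>Uniqueness of the exponents\<close>

text \<open>The induction for uniqueness runs over the initial segments of the standard product.\<close>

definition std_prefix :: "nat \<Rightarrow> nat \<Rightarrow> (nat \<Rightarrow> nat) \<Rightarrow> nat \<Rightarrow> nat" where
  "std_prefix n m e = list_mult (Sym n) (map (\<lambda>k. t n k [^]\<^bsub>Sym n\<^esub> e k) [2..<m + 1])"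

lemma std_prefix_in_Sym: "m \<le> n \<Longrightarrow> std_prefix n m e \<in> carrier (Sym n)"
  unfolding std_prefix_def
  by (intro monoid.list_mult_closed[OF group.is_monoid[OF group_Sym]]) (auto intro: t_pow_in_Sym)

lemma std_prefix_Suc:
  assumes "1 \<le> m" "m < n"
  shows "std_prefix n (Suc m) e
    = std_prefix n m e \<otimes>\<^bsub>Sym n\<^esub> t n (Suc m) [^]\<^bsub>Sym n\<^esub> e (Suc m)"
proof -
  let ?f = "\<lambda>k. t n k [^]\<^bsub>Sym n\<^esub> e k"
  have "list_mult (Sym n) (map ?f [2..<m + 1] @ [?f (Suc m)])
      = list_mult (Sym n) (map ?f [2..<m + 1]) \<otimes>\<^bsub>Sym n\<^esub> list_mult (Sym n) [?f (Suc m)]"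
    using assms by (intro monoid.list_mult_append[OF group.is_monoid[OF group_Sym]])
      (auto intro!: t_pow_in_Sym)
  then show ?thesis
    using assms by (simp add: std_prefix_def Sym_simps)
qed

lemma std_prefix_fixes:
  assumes "1 \<le> m" "m \<le> n" "\<forall>k\<in>{2..m}. e k < k" "m < j"
  shows "std_prefix n m e j = j"
  using assms
proof (induction m rule: dec_induct)
  case base
  then show ?case
    by (simp add: std_prefix_def Sym_simps)
next
  case (step m)
  then have "e (Suc m) \<le> Suc m"
    by (force simp: less_imp_le)
  then show ?case
    using step by (simp add: std_prefix_Suc Sym_simps t_pow_eq_rotation) (simp add: rotation_def)
qed

text \<open>
  The largest generator \<open>t\<^sub>m\<close> is the only factor that moves \<open>m\<close>, and its exponent is the
  distance by which the product moves \<open>m\<close> down. Cancelling this factor leaves the same situation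
  with fewer generators.
\<close>

lemma std_prefix_inj:
  assumes "1 \<le> m" "m \<le> n" "\<forall>k\<in>{2..m}. e k < k" "\<forall>k\<in>{2..m}. e' k < k"
    and "std_prefix n m e = std_prefix n m e'"
  shows "\<forall>k\<in>{2..m}. e k = e' k"
  using assms
proof (induction m rule: dec_induct)
  case base
  then show ?case
    by simp
next
  case (step m)
  note eq = step.prems(4)
  have value_at: "std_prefix n (Suc m) f (Suc m) = Suc m - f (Suc m)"
    if "\<forall>k\<in>{2..Suc m}. f k < k" for f
  proof -
    have "f (Suc m) < Suc m" "std_prefix n m f (Suc m) = Suc m"
      using that step.hyps step.prems(1) by (auto intro: std_prefix_fixes)
    then show ?thesis
      using step.hyps step.prems(1)
      by (simp add: std_prefix_Suc Sym_simps t_pow_eq_rotation) (simp add: rotation_def)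
  qed
  have "e (Suc m) < Suc m" "e' (Suc m) < Suc m"
    using step by auto
  then have last: "e (Suc m) = e' (Suc m)"
    using value_at[OF step.prems(2)] value_at[OF step.prems(3)] eq by simp
  have "std_prefix n m e = std_prefix n m e'"
    using eq step.hyps step.prems(1) last
    by (auto simp: std_prefix_Suc t_pow_in_Sym std_prefix_in_Sym
        group.right_cancel[OF group_Sym])
  then have "\<forall>k\<in>{2..m}. e k = e' k"
    using step by auto
  then show ?case
    using last by (auto simp: le_Suc_eq)
qed

lemma std_product_inj:
  assumes "e \<in> ogs_exponents n" "e' \<in> ogs_exponents n" "std_product n e = std_product n e'"
  shows "e = e'"
proof
  fix k
  have "\<forall>k\<in>{2..n}. e k = e' k"
  proof (cases "1 \<le> n")
    case True
    then show ?thesis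
      using assms by (intro std_prefix_inj)
        (auto simp: ogs_exponents_def std_product_def std_prefix_def)
  qed simp
  then show "e k = e' k"
    using assms by (cases "k \<in> {2..n}") (auto simp: ogs_exponents_def)
qed

lemma std_form_std_product:
  "e \<in> ogs_exponents n \<Longrightarrow> std_form n (std_product n e) = e"
  unfolding std_form_def by (rule the_equality) (auto intro: std_product_inj)

lemma std_product_eq_list_mult:
  assumes "sorted_wrt (<) ks" "set ks \<subseteq> {2..n}" "\<And>k. k \<notin> set ks \<Longrightarrow> e k = 0"
  shows "std_product n e = list_mult (Sym n) (map (\<lambda>k. t n k [^]\<^bsub>Sym n\<^esub> e k) ks)"
proof -
  have "filter (\<lambda>k. k \<in> set ks) [2..<n + 1] = ks"
    using assms(1,2)
    by (intro sorted_distinct_set_unique)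
      (auto simp: strict_sorted_iff sorted_wrt_filter simp del: upt_Suc)
  moreover have "list_mult (Sym n) (map (\<lambda>k. t n k [^]\<^bsub>Sym n\<^esub> e k)
        (filter (\<lambda>k. k \<in> set ks) [2..<n + 1])) = std_product n e"
    unfolding std_product_def
    by (rule monoid.list_mult_map_filter[OF group.is_monoid[OF group_Sym], of _ "{2..n}"])
      (auto intro: t_pow_in_Sym simp: assms(3))
  ultimately show ?thesis
    by simp
qed

section \<open>Inversion exchanges standard and dual-standard forms\<close>

text \<open>The exponent \<open>0\<close> has to be kept, since \<open>k - 0\<close> is not below \<open>k\<close>.\<close>

definition inv_exponents :: "(nat \<Rightarrow> nat) \<Rightarrow> nat \<Rightarrow> nat" where
  "inv_exponents e k = (if e k = 0 then 0 else k - e k)"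

lemma inv_exponents_in_ogs: "e \<in> ogs_exponents n \<Longrightarrow> inv_exponents e \<in> ogs_exponents n"
  by (force simp: ogs_exponents_def inv_exponents_def)

lemma ogs_less: "e \<in> ogs_exponents n \<Longrightarrow> e k \<noteq> 0 \<Longrightarrow> e k < k"
  by (cases "k \<in> {2..n}") (auto simp: ogs_exponents_def)

lemma inv_exponents_inv_exponents:
  assumes "e \<in> ogs_exponents n"
  shows "inv_exponents (inv_exponents e) = e"
proof
  fix k
  show "inv_exponents (inv_exponents e) k = e k"
    using ogs_less[OF assms, of k] by (auto simp: inv_exponents_def)
qed

lemma occurring_inv_exponents:
  assumes "e \<in> ogs_exponents n"
  shows "occurring (inv_exponents e) = occurring e"
  using ogs_less[OF assms] by (auto simp: inv_exponents_def occurring_def not_le)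

lemma inv_std_product:
  assumes "e \<in> ogs_exponents n"
  shows "inv\<^bsub>Sym n\<^esub> (std_product n e) = dual_std_product n (inv_exponents e)"
proof -
  have factor: "inv\<^bsub>Sym n\<^esub> (t n k [^]\<^bsub>Sym n\<^esub> e k) = t n k [^]\<^bsub>Sym n\<^esub> inv_exponents e k"
    if "k \<in> {2..n}" for k
  proof -
    have "k \<le> n" "e k \<le> k"
      using that assms by (auto simp: ogs_exponents_def less_imp_le)
    then show ?thesis
      by (cases "e k = 0")
        (simp_all add: inv_t_pow inv_exponents_def monoid.inv_one[OF group.is_monoid[OF group_Sym]])
  qed
  have "inv\<^bsub>Sym n\<^esub> (std_product n e) = list_mult (Sym n)
      (rev (map (\<lambda>x. inv\<^bsub>Sym n\<^esub> x) (map (\<lambda>k. t n k [^]\<^bsub>Sym n\<^esub> e k) [2..<n + 1])))"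
    unfolding std_product_def
    by (rule group.inv_list_mult[OF group_Sym]) (auto intro: t_pow_in_Sym)
  also have "map (\<lambda>x. inv\<^bsub>Sym n\<^esub> x) (map (\<lambda>k. t n k [^]\<^bsub>Sym n\<^esub> e k) [2..<n + 1])
      = map (\<lambda>k. t n k [^]\<^bsub>Sym n\<^esub> inv_exponents e k) [2..<n + 1]"
    using factor by auto
  finally show ?thesis
    by (simp only: dual_std_product_def rev_map)
qed

lemma std_product_in_Sym: "std_product n e \<in> carrier (Sym n)"
  using std_prefix_in_Sym[of n n e] by (simp add: std_product_def std_prefix_def)

text \<open>
  Uniqueness of the dual-standard form is inherited from the standard one: the exponents of any
  dual-standard product of \<open>\<pi>\<close>, inverted, are those of a standard product of the inverse of
  \<open>\<pi>\<close>.
\<close>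

lemma dual_std_form_eq:
  assumes "e \<in> ogs_exponents n" "\<pi> = inv\<^bsub>Sym n\<^esub> (std_product n e)"
  shows "dual_std_form n \<pi> = inv_exponents e"
  unfolding dual_std_form_def
proof (rule the_equality)
  show "inv_exponents e \<in> ogs_exponents n \<and> dual_std_product n (inv_exponents e) = \<pi>"
    using assms by (simp add: inv_std_product inv_exponents_in_ogs)
next
  fix f assume f: "f \<in> ogs_exponents n \<and> dual_std_product n f = \<pi>"
  then have "inv\<^bsub>Sym n\<^esub> (std_product n (inv_exponents f)) = inv\<^bsub>Sym n\<^esub> (std_product n e)"
    using assms(2)
    by (simp add: inv_std_product inv_exponents_in_ogs inv_exponents_inv_exponents[of f n])
  then have "std_product n (inv_exponents f) = std_product n e"
    by (metis group.inv_inv[OF group_Sym] std_product_in_Sym)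
  then have "inv_exponents f = e"
    using f assms(1) inv_exponents_in_ogs std_product_inj by blast
  then show "f = inv_exponents e"
    using f inv_exponents_inv_exponents[of f n] by simp
qed

section \<open>The standard form of a product of two powers\<close>

text \<open>
  In each case the point \<open>q\<close> determines the exponent of \<open>t\<^sub>q\<close>, and the other two rotations
  exchange adjacent blocks as explained at the top. For \<open>q - a > p\<close> the factor
  \<open>t\<^sub>p\<^sup>b\<close> does not move the image \<open>q - a\<close> of \<open>q\<close>, and the blocks exchanged form \<open>{a+1..a+p}\<close>,
  the preimage of \<open>{1..p}\<close> under \<open>t\<^sub>q\<^sup>a\<close>. For \<open>q - a = p\<close> the formula holds as well, but then both last
  factors are powers of \<open>t\<^sub>q\<close>.
\<close>

lemma rotation_comp_far:
  assumes "a + p \<le> q" "0 < a" "0 < b" "b < p"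
  shows "rotation p b \<circ> rotation q a
    = rotation q a \<circ> rotation (a + p) b \<circ> rotation (a + b) a"
proof
  fix k
  consider "k = 0" | "q < k"
    | "0 < k" "k \<le> a" | "a < k" "k \<le> a + b"
    | "a + b < k" "k \<le> a + p" | "a + p < k" "k \<le> q"
    by linarith
  then show "(rotation p b \<circ> rotation q a) k
      = (rotation q a \<circ> rotation (a + p) b \<circ> rotation (a + b) a) k"
    by cases (use assms in \<open>auto simp: rotation_def\<close>)
qed

lemma rotation_comp_border:
  assumes "a + p = q" "0 < a" "0 < b" "b < p"
  shows "rotation p b \<circ> rotation q a = rotation q (a + b) \<circ> rotation (a + b) a"
proof
  fix k
  consider "k = 0" | "q < k"
    | "0 < k" "k \<le> a" | "a < k" "k \<le> a + b"
    | "a + b < k" "k \<le> q"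
    by linarith
  then show "(rotation p b \<circ> rotation q a) k = (rotation q (a + b) \<circ> rotation (a + b) a) k"
    by cases (use assms in \<open>auto simp: rotation_def\<close>)
qed

text \<open>
  For \<open>a + b < q\<close> the point \<open>q\<close> is moved to \<open>q - a - b\<close>, and the blocks exchanged are \<open>{a+p-q+1..a}\<close> and
  \<open>{a+1..a+b}\<close>. For \<open>a + b = q\<close> the powers of \<open>t\<^sub>q\<close> are \<open>t\<^sub>q\<^sup>q\<^sup>-\<^sup>p\<close> and the
  identity.
\<close>

lemma rotation_comp_middle:
  assumes "q < a + p" "a + b \<le> q" "p < q" "a < q" "0 < b"
  shows "rotation p b \<circ> rotation q a
    = rotation q (a + b) \<circ> rotation (a + b) (q - p) \<circ> rotation a (a + p - q)"
proof
  fix k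
  consider "k = 0" | "q < k"
    | "0 < k" "k \<le> a + p - q" | "a + p - q < k" "k \<le> a"
    | "a < k" "k \<le> a + b" | "a + b < k" "k \<le> q"
    by linarith
  then show "(rotation p b \<circ> rotation q a) k
      = (rotation q (a + b) \<circ> rotation (a + b) (q - p) \<circ> rotation a (a + p - q)) k"
    by cases (use assms in \<open>auto simp: rotation_def\<close>)
qed

text \<open>
  Here \<open>q - a\<close> lies among the points which \<open>t\<^sub>p\<^sup>b\<close> wraps around, so \<open>q\<close> goes to
  \<open>q - a - b + p\<close>, and the blocks exchanged are \<open>{a+b-q+1..a+p-q}\<close> and \<open>{a+p-q+1..a}\<close>.
\<close>

lemma rotation_comp_near:
  assumes "q < a + b" "b < p" "p < q" "a < q"
  shows "rotation p b \<circ> rotation q a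
    = rotation q (a + b - p) \<circ> rotation a (p - b) \<circ> rotation (a + p - q) (a + b - q)"
proof -
  \<comment> \<open>Cutting \<open>{1..q}\<close> after \<open>a + b - q\<close>, \<open>a + p - q\<close> and \<open>a\<close> gives blocks of lengths
    \<open>r\<close>, \<open>d\<close>, \<open>e\<close>, \<open>c\<close>. In terms of these lengths all subtractions disappear.\<close>
  define r d e c where "r = a + b - q" and "d = p - b" and "e = q - p" and "c = q - a"
  have eqs: "a = r + d + e" "b = r + c" "p = r + c + d" "q = r + d + e + c"
      "a + b - p = r + e" "p - b = d" "a + p - q = r + d" "a + b - q = r"
    using assms by (auto simp: r_def d_def e_def c_def)
  have pos: "0 < d" "0 < e" "0 < c" "0 < r"
    using assms by (auto simp: r_def d_def e_def c_def)
  have "(rotation (r + c + d) (r + c) \<circ> rotation (r + d + e + c) (r + d + e)) k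
      = (rotation (r + d + e + c) (r + e) \<circ> rotation (r + d + e) d \<circ> rotation (r + d) r) k"
    for k
  proof -
    consider "k = 0" | "r + d + e + c < k" | "0 < k" "k \<le> r"
      | "r < k" "k \<le> r + d" | "r + d < k" "k \<le> r + d + e"
      | "r + d + e < k" "k \<le> r + d + e + c"
      by linarith
    then show ?thesis
      by cases (use pos in \<open>auto simp: rotation_def\<close>)
  qed
  then show ?thesis
    unfolding eqs(5-8) unfolding eqs(1-4) by blast
qed

lemma t_pow_mult_t_pow:
  assumes "p \<le> n" "q \<le> n" "a \<le> q" "b \<le> p"
  shows "t n q [^]\<^bsub>Sym n\<^esub> a \<otimes>\<^bsub>Sym n\<^esub> t n p [^]\<^bsub>Sym n\<^esub> b = rotation p b \<circ> rotation q a"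
  using assms by (simp add: t_pow_eq_rotation Sym_simps)

lemma two_factor_form:
  assumes "0 < i" "i < A" "A < B" "0 < j" "j < B" "B \<le> n"
  shows "\<exists>e\<in>ogs_exponents n. std_product n e = rotation B j \<circ> rotation A i
    \<and> card (occurring e) = 2"
proof -
  define e :: "nat \<Rightarrow> nat" where "e = (\<lambda>_. 0)(A := i, B := j)"
  have "e \<in> ogs_exponents n"
    using assms by (auto simp: e_def ogs_exponents_def)
  moreover have "std_product n e = rotation B j \<circ> rotation A i"
    using assms
    by (subst std_product_eq_list_mult[of "[A, B]"])
      (auto simp: e_def t_pow_eq_rotation Sym_simps)
  moreover have "occurring e = {A, B}"
    using assms by (auto simp: e_def occurring_def)
  ultimately show ?thesis
    using assms by (intro bexI[of _ e]) auto
qed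

lemma three_factor_form:
  assumes "0 < i" "i < A" "A < B" "0 < j" "j < B" "B < C" "0 < k" "k < C" "C \<le> n"
  shows "\<exists>e\<in>ogs_exponents n. std_product n e = rotation C k \<circ> rotation B j \<circ> rotation A i
    \<and> card (occurring e) = 3"
proof -
  define e :: "nat \<Rightarrow> nat" where "e = (\<lambda>_. 0)(A := i, B := j, C := k)"
  have "e \<in> ogs_exponents n"
    using assms by (auto simp: e_def ogs_exponents_def)
  moreover have "std_product n e = rotation C k \<circ> rotation B j \<circ> rotation A i"
    using assms
    by (subst std_product_eq_list_mult[of "[A, B, C]"])
      (auto simp: e_def t_pow_eq_rotation Sym_simps comp_assoc)
  moreover have "occurring e = {A, B, C}"
    using assms by (auto simp: e_def occurring_def)
  ultimately show ?thesis
    using assms by (intro bexI[of _ e]) auto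
qed

lemma product_border:
  assumes "q - a = p" "q \<le> n" "0 < a" "a < q" "0 < b" "b < p"
  shows "t n q [^]\<^bsub>Sym n\<^esub> a \<otimes>\<^bsub>Sym n\<^esub> t n p [^]\<^bsub>Sym n\<^esub> b
    = t n (a + b) [^]\<^bsub>Sym n\<^esub> a \<otimes>\<^bsub>Sym n\<^esub> t n q [^]\<^bsub>Sym n\<^esub> (a + b)"
  using assms rotation_comp_border[of a p q b] by (simp add: t_pow_mult_t_pow)

lemma rotation_comp_wrap:
  assumes "q - a = b" "p < q" "a < q" "b < p"
  shows "rotation p b \<circ> rotation q a = rotation q (q - p) \<circ> rotation a (p - b)"
proof -
  have "a + b = q" "a + p - q = p - b"
    using assms by auto
  then show ?thesis
    using assms rotation_comp_middle[of q a p b] by (simp add: rotation_self)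
qed

lemma product_wrap:
  assumes "q - a = b" "p < q" "q \<le> n" "a < q" "b < p"
  shows "t n q [^]\<^bsub>Sym n\<^esub> a \<otimes>\<^bsub>Sym n\<^esub> t n p [^]\<^bsub>Sym n\<^esub> b
    = t n a [^]\<^bsub>Sym n\<^esub> (p - b) \<otimes>\<^bsub>Sym n\<^esub> t n q [^]\<^bsub>Sym n\<^esub> (q - p)"
  using assms rotation_comp_wrap[of q a b p] by (simp add: t_pow_mult_t_pow)

lemma standard_form_of_product:
  assumes "p < q" "q \<le> n" "0 < a" "a < q" "0 < b" "b < p"
  shows "\<exists>e\<in>ogs_exponents n.
    std_product n e = t n q [^]\<^bsub>Sym n\<^esub> a \<otimes>\<^bsub>Sym n\<^esub> t n p [^]\<^bsub>Sym n\<^esub> b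
    \<and> card (occurring e) = (if q - a = p \<or> q - a = b then 2 else 3)"
proof -
  have x: "t n q [^]\<^bsub>Sym n\<^esub> a \<otimes>\<^bsub>Sym n\<^esub> t n p [^]\<^bsub>Sym n\<^esub> b = rotation p b \<circ> rotation q a"
    using assms by (simp add: t_pow_mult_t_pow)
  consider (far) "p < q - a" | (border) "q - a = p" | (middle) "q - a < p" "b < q - a"
    | (wrap) "q - a = b" | (near) "q - a < b"
    using assms by linarith
  then show ?thesis
  proof cases
    case far
    then show ?thesis
      unfolding x using assms three_factor_form[of a "a + b" "a + p" b q a n]
      by (simp add: rotation_comp_far)
  next
    case border
    then show ?thesis
      unfolding x using assms two_factor_form[of a "a + b" q "a + b" n]
      by (simp add: rotation_comp_border)
  next
    case middle
    then show ?thesis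
      unfolding x using assms three_factor_form[of "a + p - q" a "a + b" "q - p" q "a + b" n]
      by (simp add: rotation_comp_middle)
  next
    case wrap
    then show ?thesis
      unfolding x using assms two_factor_form[of "p - b" a q "q - p" n]
      by (simp add: rotation_comp_wrap)
  next
    case near
    then show ?thesis
      unfolding x
      using assms three_factor_form[of "a + b - q" "a + p - q" a "p - b" q "a + b - p" n]
      by (simp add: rotation_comp_near)
  qed
qed

theorem proposition3p5:
  fixes n p q iq ip iq' ip' :: nat
  assumes "2 \<le> p" and "p < q" and "q \<le> n"
    and "0 < iq" and "iq < q" and "0 < ip" and "ip < p"
    and "0 < iq'" and "iq' < q" and "0 < ip'" and "ip' < p"
  defines "x \<equiv> t n q [^]\<^bsub>Sym n\<^esub> iq \<otimes>\<^bsub>Sym n\<^esub> t n p [^]\<^bsub>Sym n\<^esub> ip"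
    and "y \<equiv> t n p [^]\<^bsub>Sym n\<^esub> ip' \<otimes>\<^bsub>Sym n\<^esub> t n q [^]\<^bsub>Sym n\<^esub> iq'"
  shows "card (occurring (std_form n x)) \<le> 3 \<and> card (occurring (dual_std_form n y)) \<le> 3
    \<and> (card (occurring (std_form n x)) = 2 \<longleftrightarrow> q - iq = p \<or> q - iq = ip)
    \<and> (q - iq = p \<longrightarrow>
         x = t n (iq + ip) [^]\<^bsub>Sym n\<^esub> iq \<otimes>\<^bsub>Sym n\<^esub> t n q [^]\<^bsub>Sym n\<^esub> (iq + ip))
    \<and> (q - iq = ip \<longrightarrow>
         x = t n iq [^]\<^bsub>Sym n\<^esub> (p - ip) \<otimes>\<^bsub>Sym n\<^esub> t n q [^]\<^bsub>Sym n\<^esub> (q - p))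
    \<and> (card (occurring (dual_std_form n y)) = 2 \<longleftrightarrow> iq' = p \<or> iq' = p - ip')
    \<and> (iq' = p \<longrightarrow>
         y = t n q [^]\<^bsub>Sym n\<^esub> ip' \<otimes>\<^bsub>Sym n\<^esub> t n (q - ip') [^]\<^bsub>Sym n\<^esub> (p - ip'))
    \<and> (iq' = p - ip' \<longrightarrow>
         y = t n q [^]\<^bsub>Sym n\<^esub> p \<otimes>\<^bsub>Sym n\<^esub> t n (q - iq') [^]\<^bsub>Sym n\<^esub> (q - p))"
proof -
  \<comment> \<open>\<open>y\<close> is the inverse of a product \<open>z\<close> of the same shape as \<open>x\<close>.\<close>
  define z where "z = t n q [^]\<^bsub>Sym n\<^esub> (q - iq') \<otimes>\<^bsub>Sym n\<^esub> t n p [^]\<^bsub>Sym n\<^esub> (p - ip')"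
  have inv_mult: "inv\<^bsub>Sym n\<^esub> (t n k [^]\<^bsub>Sym n\<^esub> i \<otimes>\<^bsub>Sym n\<^esub> t n l [^]\<^bsub>Sym n\<^esub> j)
      = t n l [^]\<^bsub>Sym n\<^esub> (l - j) \<otimes>\<^bsub>Sym n\<^esub> t n k [^]\<^bsub>Sym n\<^esub> (k - i)"
    if "k \<le> n" "l \<le> n" "i \<le> k" "j \<le> l" for k l i j
    using that by (simp add: group.inv_mult_group[OF group_Sym] t_pow_in_Sym inv_t_pow)
  have y: "y = inv\<^bsub>Sym n\<^esub> z"
    using assms(1-11) by (simp add: y_def z_def inv_mult)

  obtain e where e: "e \<in> ogs_exponents n" "std_product n e = x"
      "card (occurring e) = (if q - iq = p \<or> q - iq = ip then 2 else 3)"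
    using standard_form_of_product[of p q n iq ip] assms(1-11) by (auto simp: x_def)
  obtain f where f: "f \<in> ogs_exponents n" "std_product n f = z"
      "card (occurring f) = (if iq' = p \<or> iq' = p - ip' then 2 else 3)"
    using standard_form_of_product[of p q n "q - iq'" "p - ip'"] assms(1-11)
    by (auto simp: z_def)
  have "std_form n x = e"
    using e std_form_std_product by blast
  moreover have "occurring (dual_std_form n y) = occurring f"
    using f y by (simp add: dual_std_form_eq occurring_inv_exponents)
  moreover have "x = t n (iq + ip) [^]\<^bsub>Sym n\<^esub> iq \<otimes>\<^bsub>Sym n\<^esub> t n q [^]\<^bsub>Sym n\<^esub> (iq + ip)"
    if "q - iq = p"
    unfolding x_def by (rule product_border) (use that assms(1-11) in auto)
  moreover have "x = t n iq [^]\<^bsub>Sym n\<^esub> (p - ip) \<otimes>\<^bsub>Sym n\<^esub> t n q [^]\<^bsub>Sym n\<^esub> (q - p)"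
    if "q - iq = ip"
    unfolding x_def by (rule product_wrap) (use that assms(1-11) in auto)
  moreover have "y = t n q [^]\<^bsub>Sym n\<^esub> ip' \<otimes>\<^bsub>Sym n\<^esub> t n (q - ip') [^]\<^bsub>Sym n\<^esub> (p - ip')"
    if "iq' = p"
  proof -
    have eqs: "q - iq' + (p - ip') = q - ip'" "q - (q - ip') = ip'"
        "q - ip' - (q - iq') = p - ip'"
      using that assms(1-11) by auto
    have "z = t n (q - ip') [^]\<^bsub>Sym n\<^esub> (q - iq') \<otimes>\<^bsub>Sym n\<^esub> t n q [^]\<^bsub>Sym n\<^esub> (q - ip')"
      unfolding z_def eqs(1)[symmetric] by (rule product_border) (use that assms(1-11) in auto)
    then show ?thesis
      using that assms(1-11) eqs by (simp add: y inv_mult)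
  qed
  moreover have "y = t n q [^]\<^bsub>Sym n\<^esub> p \<otimes>\<^bsub>Sym n\<^esub> t n (q - iq') [^]\<^bsub>Sym n\<^esub> (q - p)"
    if "iq' = p - ip'"
  proof -
    have eqs: "p - (p - ip') = ip'" "q - (q - p) = p" "q - iq' - ip' = q - p"
      using that assms(1-11) by auto
    have "z = t n (q - iq') [^]\<^bsub>Sym n\<^esub> (p - (p - ip')) \<otimes>\<^bsub>Sym n\<^esub> t n q [^]\<^bsub>Sym n\<^esub> (q - p)"
      unfolding z_def by (rule product_wrap) (use that assms(1-11) in auto)
    then have "z = t n (q - iq') [^]\<^bsub>Sym n\<^esub> ip' \<otimes>\<^bsub>Sym n\<^esub> t n q [^]\<^bsub>Sym n\<^esub> (q - p)"
      by (simp only: eqs)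
    then have "y = t n q [^]\<^bsub>Sym n\<^esub> (q - (q - p))
        \<otimes>\<^bsub>Sym n\<^esub> t n (q - iq') [^]\<^bsub>Sym n\<^esub> (q - iq' - ip')"
      using that assms(1-11) by (simp only: y, subst inv_mult) auto
    then show ?thesis
      by (simp only: eqs)
  qed
  ultimately show ?thesis
    using e(3) f(3) by simp
qed

end
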